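(* Let $k\ge1$ be an integer. In the dyadic simulation tree described in the context, assume that the random objects $S^0_0,\ (C^0_i)_{0\le i<1},\ (C^1_i)_{0\le i<2},\ \dots,\ (C^{m-1}_i)_{0\le i<2^{m-1}}$ are mutually independent (i.e., $S^0_0$ and the $m$ level-wise seed families are independent of one another), and that for each level $l$ the family $(C^l_i)_{0\le i<2^l}$ is $k$-wise independent, meaning any $k$ distinct members of it are mutually independent. Then for every $l$ with $1\le l\le m$, the $2^l$ range-sums $S^l_0,S^l_1,\dots,S^l_{2^l-1}$ are $k$-wise independent.
   Context: Let $m\ge1$ and $U=2^m$. Let $X$ be a probability distribution on $\mathbb{R}$; for $n\ge1$, $X^{*n}$ denotes its $n$-fold convolution power (the law of the sum of $n$ i.i.d. $X$-distributed random variables). Let $(E,\mathcal{E})$ be a measurable space with a probability measure $\nu$. For each $n\in\{1,2,4,\dots,U/2\}$ let $\theta_n:E\times\mathbb{R}\to\mathbb{R}$ be a measurable function with the following splitting property: whenever $S$ has law $X^{*2n}$ and $C$ has law $\nu$ and is independent of $S$, the random variables $\theta_n(C,S)$ and $S-\theta_n(C,S)$ are independent and each has law $X^{*n}$. Dyadic simulation tree: let $S^0_0$ be a random variable with law $X^{*U}$ and let $C^l_i$ ($0\le l\le m-1$, $0\le i<2^l$) be $E$-valued random variables each with law $\nu$ (in practice $C^l_i=h^l(i)$ for a per-level hash function $h^l$). Define recursively, for $l=0,\dots,m-1$ and $0\le i<2^l$, $S^{l+1}_{2i}=\theta_{U/2^{l+1}}(C^l_i,S^l_i)$ and $S^{l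+1}_{2i+1}=S^l_i-S^{l+1}_{2i}$.
   Formalization: k-wise independence is read, in hypothesis and conclusion, as mutual independence of any at most k distinct members, since with "any k" the condition is vacuous on levels with fewer than k seeds and the claim fails (e.g. k=3, m=2, Gaussian X, equal seeds on level 1). *)

theory Defs
  imports "HOL-Probability.Probability"
begin

primrec conv_power :: "real measure \<Rightarrow> nat \<Rightarrow> real measure" where
  "conv_power X 0 = return borel 0"
| "conv_power X (Suc n) = (X \<star> conv_power X n)"

text \<open>
  The events generated by a random variable. Independence of random variables with values in
  different types is stated through these events, exactly as \<open>indep_vars_def2\<close> does
  when the types agree (\<open>indep_vars\<close> and \<open>indep_var\<close> force a common value type).
\<close>

definition rv_events :: "'w measure \<Rightarrow> 'b measure \<Rightarrow> ('w \<Rightarrow> 'b) \<Rightarrow> 'w set set" where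
  "rv_events M N f = {f -` A \<inter> space M | A. A \<in> sets N}"

text \<open>
  The splitting property quantifies over all probability spaces carrying a suitable pair
  \<open>(C, S)\<close>. Since a formula cannot quantify over types, the sample space is taken on the type
  \<open>'e \<times> real\<close>, which has room for the product space of the two laws; the lemma
  \<open>splitting_map_any_space\<close> below shows that the property then holds over every sample space.
\<close>

definition splitting_map :: "real measure \<Rightarrow> 'e measure \<Rightarrow> nat \<Rightarrow> ('e \<times> real \<Rightarrow> real) \<Rightarrow> bool" where
  "splitting_map X \<nu> n \<theta> \<longleftrightarrow>
     (\<forall>(P :: ('e \<times> real) measure) C S.
        prob_space P \<and> C \<in> measurable P \<nu> \<and> S \<in> borel_measurable P \<and>
        distr P \<nu> C = \<nu> \<and> distr P borel S = conv_power X (2 * n) \<and>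
        prob_space.indep_set P (rv_events P \<nu> C) (rv_events P borel S) \<longrightarrow>
        prob_space.indep_var P borel (\<lambda>\<omega>. \<theta> (C \<omega>, S \<omega>)) borel (\<lambda>\<omega>. S \<omega> - \<theta> (C \<omega>, S \<omega>)) \<and>
        distr P borel (\<lambda>\<omega>. \<theta> (C \<omega>, S \<omega>)) = conv_power X n \<and>
        distr P borel (\<lambda>\<omega>. S \<omega> - \<theta> (C \<omega>, S \<omega>)) = conv_power X n)"

text \<open>
  Subfamilies of size at most \<open>k\<close> rather than exactly \<open>k\<close>: the two agree as soon as the family
  has \<open>k\<close> members; a smaller family, for which the exact version would be vacuous, is required to
  be mutually independent.
\<close>

definition kwise_indep_vars ::
  "'w measure \<Rightarrow> nat \<Rightarrow> ('i \<Rightarrow> 'b measure) \<Rightarrow> ('i \<Rightarrow> 'w \<Rightarrow> 'b) \<Rightarrow> 'i set \<Rightarrow> bool" where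
  "kwise_indep_vars M k N F I \<longleftrightarrow>
     (\<forall>J. J \<subseteq> I \<and> finite J \<and> card J \<le> k \<longrightarrow> prob_space.indep_vars M N F J)"

text \<open>
  Mutual independence of the root variable and the \<open>m\<close> level families, the latter viewed as random
  vectors. The index \<open>None\<close> stands for the root, \<open>Some l\<close> for level \<open>l\<close>.
\<close>

definition indep_root_levels ::
  "'w measure \<Rightarrow> 'e measure \<Rightarrow> nat \<Rightarrow> ('w \<Rightarrow> real) \<Rightarrow> (nat \<Rightarrow> nat \<Rightarrow> 'w \<Rightarrow> 'e) \<Rightarrow> bool" where
  "indep_root_levels M \<nu> m R C \<longleftrightarrow>
     prob_space.indep_sets M
       (\<lambda>j. case j of
          None \<Rightarrow> rv_events M borel R
        | Some l \<Rightarrow> rv_events M (PiM {..<2 ^ l} (\<lambda>_. \<nu>)) (\<lambda>\<omega>. \<lambda>i\<in>{..<2 ^ l}. C l i \<omega>))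
       (insert None (Some ` {..<m}))"

lemma sets_conv_power [simp, measurable_cong]: "sets (conv_power X n) = sets borel"
  by (cases n) (simp_all add: convolution_def)

lemma splitting_map_any_space:
  fixes M :: "'w measure" and \<nu> :: "'e measure" and \<theta> :: "'e \<times> real \<Rightarrow> real"
  assumes split: "splitting_map X \<nu> n \<theta>"
    and \<theta> [measurable]: "\<theta> \<in> borel_measurable (\<nu> \<Otimes>\<^sub>M borel)"
    and M: "prob_space M"
    and C [measurable]: "C \<in> measurable M \<nu>" and S [measurable]: "S \<in> borel_measurable M"
    and lawC: "distr M \<nu> C = \<nu>" and lawS: "distr M borel S = conv_power X (2 * n)"
    and ind: "prob_space.indep_set M (rv_events M \<nu> C) (rv_events M borel S)"
  shows "prob_space.indep_var M borel (\<lambda>\<omega>. \<theta> (C \<omega>, S \<omega>)) borel (\<lambda>\<omega>. S \<omega> - \<theta> (C \<omega>, S \<omega>))"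
    and "distr M borel (\<lambda>\<omega>. \<theta> (C \<omega>, S \<omega>)) = conv_power X n"
    and "distr M borel (\<lambda>\<omega>. S \<omega> - \<theta> (C \<omega>, S \<omega>)) = conv_power X n"
proof -
  interpret M: prob_space M by fact
  define Q where "Q = distr M (\<nu> \<Otimes>\<^sub>M borel) (\<lambda>\<omega>. (C \<omega>, S \<omega>))"
  have [measurable_cong]: "sets Q = sets (\<nu> \<Otimes>\<^sub>M borel)"
    by (simp add: Q_def)
  interpret Q: prob_space Q
    unfolding Q_def by (rule M.prob_space_distr) measurable
  have Q_distr: "distr Q N f = distr M N (\<lambda>\<omega>. f (C \<omega>, S \<omega>))"
    if "f \<in> measurable (\<nu> \<Otimes>\<^sub>M borel) N" for f and N :: "'z measure"
    unfolding Q_def using that by (subst distr_distr) (simp_all add: comp_def)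
  have spQ: "space Q = space \<nu> \<times> UNIV"
    by (simp add: Q_def space_pair_measure)
  have indQ: "Q.indep_set (rv_events Q \<nu> fst) (rv_events Q borel snd)"
    unfolding Q.indep_sets2_eq
  proof (intro conjI ballI)
    show "rv_events Q \<nu> fst \<subseteq> Q.events" "rv_events Q borel snd \<subseteq> Q.events"
      by (auto simp: rv_events_def)
    fix a b assume "a \<in> rv_events Q \<nu> fst" "b \<in> rv_events Q borel snd"
    then obtain A B where A [measurable]: "A \<in> sets \<nu>" and a: "a = fst -` A \<inter> space Q"
      and B [measurable]: "B \<in> sets borel" and b: "b = snd -` B \<inter> space Q"
      by (auto simp: rv_events_def)
    let ?f = "\<lambda>\<omega>. (C \<omega>, S \<omega>)"
    have ab [measurable]: "a \<in> sets (\<nu> \<Otimes>\<^sub>M borel)" "b \<in> sets (\<nu> \<Otimes>\<^sub>M borel)"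
      using measurable_sets[of fst Q \<nu> A] measurable_sets[of snd Q borel B]
      by (simp_all add: a b Q_def)
    have pre: "?f -` a \<inter> space M = C -` A \<inter> space M" "?f -` b \<inter> space M = S -` B \<inter> space M"
      using measurable_space[OF C] by (auto simp: a b spQ)
    have pre2: "?f -` (a \<inter> b) \<inter> space M = (C -` A \<inter> space M) \<inter> (S -` B \<inter> space M)"
      using pre by auto
    have "M.prob ((C -` A \<inter> space M) \<inter> (S -` B \<inter> space M)) =
          M.prob (C -` A \<inter> space M) * M.prob (S -` B \<inter> space M)"
      by (rule M.indep_setD[OF ind]) (auto simp: rv_events_def)
    then show "Q.prob (a \<inter> b) = Q.prob a * Q.prob b"
      unfolding Q_def by (simp add: measure_distr pre pre2 del: vimage_Int)
  qed
  have *: "Q.indep_var borel (\<lambda>p. \<theta> (fst p, snd p)) borel (\<lambda>p. snd p - \<theta> (fst p, snd p)) \<and>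
        distr Q borel (\<lambda>p. \<theta> (fst p, snd p)) = conv_power X n \<and>
        distr Q borel (\<lambda>p. snd p - \<theta> (fst p, snd p)) = conv_power X n"
    using split[unfolded splitting_map_def, rule_format, of Q fst snd] indQ
    by (simp add: Q_distr lawC lawS Q.prob_space_axioms)
  then show "distr M borel (\<lambda>\<omega>. \<theta> (C \<omega>, S \<omega>)) = conv_power X n"
    and "distr M borel (\<lambda>\<omega>. S \<omega> - \<theta> (C \<omega>, S \<omega>)) = conv_power X n"
    by (simp_all add: Q_distr)
  show "M.indep_var borel (\<lambda>\<omega>. \<theta> (C \<omega>, S \<omega>)) borel (\<lambda>\<omega>. S \<omega> - \<theta> (C \<omega>, S \<omega>))"
    using conjunct1[OF *] unfolding Q.indep_var_distribution_eq M.indep_var_distribution_eq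
    by (simp add: Q_distr)
qed

end

theory Submission
  imports Defs
begin

text \<open>
  Induction on the level. The level-\<open>l\<close> sums depend only on the root and on the seeds of the levels
  below \<open>l\<close>, hence are jointly independent of the seeds of level \<open>l\<close>. At most \<open>k\<close> sums of level
  \<open>l + 1\<close> have at most \<open>k\<close> parents; for these parents the pairs (seed, sum) are mutually
  independent, so the pairs of children are mutually independent across parents, while the splitting
  property makes the two children of a single parent independent of each other.
\<close>

text \<open>Measurable rectangles form an intersection-stable generator of the product
  sigma-algebra, so the product formula is checked on them only. There the events of all
  \<open>A i\<close> lie in \<open>F\<close> and those of all \<open>B i\<close> in
  \<open>G\<close>: the probability splits first between \<open>F\<close> and \<open>G\<close>, then
  inside each family, and the factors are regrouped by index.\<close>

lemma (in prob_space) indep_vars_Pair: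
  assumes "finite I"
    and A: "indep_vars N A I" and B: "indep_vars N' B I"
    and FG: "indep_set (sets F) (sets G)" and space: "space F = space M" "space G = space M"
    and AF: "\<And>i. i \<in> I \<Longrightarrow> A i \<in> measurable F (N i)"
    and BG: "\<And>i. i \<in> I \<Longrightarrow> B i \<in> measurable G (N' i)"
  shows "indep_vars (\<lambda>i. N i \<Otimes>\<^sub>M N' i) (\<lambda>i \<omega>. (A i \<omega>, B i \<omega>)) I"
\<comment> \<open>The criterion \<open>indep_vars_finite\<close> needs a nonempty index set: an
  empty intersection would be \<open>UNIV\<close> instead of \<open>space M\<close>.\<close>
proof (cases "I = {}")
  case True
  then show ?thesis by (simp add: indep_vars_def2 indep_sets_def)
next
  case False
  let ?E = "\<lambda>i. {a \<times> b | a b. a \<in> sets (N i) \<and> b \<in> sets (N' i)}"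
  have rvA: "\<And>i. i \<in> I \<Longrightarrow> random_variable (N i) (A i)"
    and rvB: "\<And>i. i \<in> I \<Longrightarrow> random_variable (N' i) (B i)"
    using A B by (auto simp: indep_vars_def2)
  show ?thesis
  proof (subst indep_vars_finite[where E = ?E])
    fix i assume i: "i \<in> I"
    show "sets (N i \<Otimes>\<^sub>M N' i) = sigma_sets (space (N i \<Otimes>\<^sub>M N' i)) (?E i)"
      by (simp add: sets_pair_measure space_pair_measure)
    show "random_variable (N i \<Otimes>\<^sub>M N' i) (\<lambda>\<omega>. (A i \<omega>, B i \<omega>))"
      using rvA[OF i] rvB[OF i] by measurable
    show "Int_stable (?E i)" by (rule Int_stable_pair_measure_generator)
    show "space (N i \<Otimes>\<^sub>M N' i) \<in> ?E i" by (auto simp: space_pair_measure)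
    show "?E i \<subseteq> Pow (space (N i \<Otimes>\<^sub>M N' i))"
      by (auto simp: space_pair_measure dest: sets.sets_into_space)
  next
    show "\<forall>R\<in>Pi I ?E. prob (\<Inter>j\<in>I. (\<lambda>\<omega>. (A j \<omega>, B j \<omega>)) -` R j \<inter> space M) =
      (\<Prod>j\<in>I. prob ((\<lambda>\<omega>. (A j \<omega>, B j \<omega>)) -` R j \<inter> space M))"
    proof
      fix R assume "R \<in> Pi I ?E"
      then have "\<forall>i\<in>I. \<exists>a b. R i = a \<times> b \<and> a \<in> sets (N i) \<and> b \<in> sets (N' i)"
        by (auto simp: Pi_iff)
      then obtain a b where R: "\<And>i. i \<in> I \<Longrightarrow> R i = a i \<times> b i"
        and a: "\<And>i. i \<in> I \<Longrightarrow> a i \<in> sets (N i)" and b: "\<And>i. i \<in> I \<Longrightarrow> b i \<in> sets (N' i)"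
        by metis
      let ?a = "\<lambda>i. A i -` a i \<inter> space M" and ?b = "\<lambda>i. B i -` b i \<inter> space M"
      have aF: "?a i \<in> sets F" and bG: "?b i \<in> sets G" if "i \<in> I" for i
        using measurable_sets[OF AF[OF that] a[OF that]] measurable_sets[OF BG[OF that] b[OF that]]
        by (simp_all add: space)
      have pre: "(\<lambda>\<omega>. (A i \<omega>, B i \<omega>)) -` R i \<inter> space M = ?a i \<inter> ?b i" if "i \<in> I" for i
        using R[OF that] by auto
      have "(\<Inter>j\<in>I. (\<lambda>\<omega>. (A j \<omega>, B j \<omega>)) -` R j \<inter> space M) = (\<Inter>j\<in>I. ?a j) \<inter> (\<Inter>j\<in>I. ?b j)"
        using False pre by auto
      also have "prob \<dots> = prob (\<Inter>j\<in>I. ?a j) * prob (\<Inter>j\<in>I. ?b j)"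
        by (intro indep_setD[OF FG] sets.finite_INT False \<open>finite I\<close> aF bG)
      also have "\<dots> = (\<Prod>j\<in>I. prob (?a j)) * (\<Prod>j\<in>I. prob (?b j))"
        using indep_varsD_finite[OF A False \<open>finite I\<close> a]
          indep_varsD_finite[OF B False \<open>finite I\<close> b] by simp
      also have "\<dots> = (\<Prod>j\<in>I. prob (?a j) * prob (?b j))"
        by (rule prod.distrib[symmetric])
      also have "\<dots> = (\<Prod>j\<in>I. prob ((\<lambda>\<omega>. (A j \<omega>, B j \<omega>)) -` R j \<inter> space M))"
        by (intro prod.cong refl) (simp only: pre indep_setD[OF FG aF bG])
      finally show "prob (\<Inter>j\<in>I. (\<lambda>\<omega>. (A j \<omega>, B j \<omega>)) -` R j \<inter> space M) =
        (\<Prod>j\<in>I. prob ((\<lambda>\<omega>. (A j \<omega>, B j \<omega>)) -` R j \<inter> space M))" .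
    qed
  qed (use False \<open>finite I\<close> in auto)
qed

text \<open>The blocks \<open>{2 * i, 2 * i + 1}\<close> are pairwise disjoint, so a product over
  their union is a product of block products. Independence of the pairs factors an event across
  blocks, and \<open>within\<close> factors it inside each block.\<close>

lemma (in prob_space) indep_vars_unpair:
  fixes Y :: "nat \<Rightarrow> 'a \<Rightarrow> 'b"
  assumes "finite I"
    and pairs: "indep_vars (\<lambda>_. N \<Otimes>\<^sub>M N) (\<lambda>i \<omega>. (Y (2 * i) \<omega>, Y (2 * i + 1) \<omega>)) I"
    and within: "\<And>i. i \<in> I \<Longrightarrow> indep_var N (Y (2 * i)) N (Y (2 * i + 1))"
  shows "indep_vars (\<lambda>_. N) Y (\<Union>i\<in>I. {2 * i, 2 * i + 1})"
proof (cases "I = {}")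
  case True
  then show ?thesis by (simp add: indep_vars_def2 indep_sets_def)
next
  case False
  let ?J = "\<Union>i\<in>I. {2 * i, 2 * i + 1}"
  show ?thesis
  proof (subst indep_vars_finite[where E = "\<lambda>_. sets N"])
    show "?J \<noteq> {}" "finite ?J" using False \<open>finite I\<close> by auto
    show "random_variable N (Y j)" if "j \<in> ?J" for j
      using that indep_var_rv1[OF within] indep_var_rv2[OF within] by auto
    show "\<forall>A\<in>?J \<rightarrow> sets N. prob (\<Inter>j\<in>?J. Y j -` A j \<inter> space M) =
      (\<Prod>j\<in>?J. prob (Y j -` A j \<inter> space M))"
    proof
      fix A assume A: "A \<in> ?J \<rightarrow> sets N"
      let ?Y = "\<lambda>i \<omega>. (Y (2 * i) \<omega>, Y (2 * i + 1) \<omega>)"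
      let ?A = "\<lambda>i. A (2 * i) \<times> A (2 * i + 1)"
      have disj: "{2 * i, 2 * i + 1} \<inter> {2 * j, 2 * j + 1} = {}" if "i \<noteq> j" for i j :: nat
        using that by (auto; presburger)
      have A': "A (2 * i) \<in> sets N" "A (2 * i + 1) \<in> sets N" if "i \<in> I" for i
        using A that by (auto simp: Pi_iff)
      \<comment> \<open>Two conditions on the components of a pair amount to one condition on the
        pair, with a rectangle as test set. This turns the event into one to which
        \<open>pairs\<close> applies.\<close>
      have Int: "(\<Inter>j\<in>?J. Y j -` A j \<inter> space M) = (\<Inter>i\<in>I. ?Y i -` ?A i \<inter> space M)"
        using False by auto
      have "prob (\<Inter>j\<in>?J. Y j -` A j \<inter> space M) = (\<Prod>i\<in>I. prob (?Y i -` ?A i \<inter> space M))"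
        unfolding Int using A' by (intro indep_varsD_finite[OF pairs False \<open>finite I\<close>]) auto
      also have "\<dots> = (\<Prod>i\<in>I. \<Prod>j\<in>{2 * i, 2 * i + 1}. prob (Y j -` A j \<inter> space M))"
      proof (rule prod.cong[OF refl])
        fix i assume i: "i \<in> I"
        have two: "prod f {2 * i, 2 * i + 1} = f (2 * i) * f (2 * i + 1)" for f :: "nat \<Rightarrow> real"
          by simp
        show "prob (?Y i -` ?A i \<inter> space M) =
          (\<Prod>j\<in>{2 * i, 2 * i + 1}. prob (Y j -` A j \<inter> space M))"
          unfolding two by (rule indep_varD[OF within[OF i] A'[OF i]])
      qed
      also have "\<dots> = (\<Prod>j\<in>?J. prob (Y j -` A j \<inter> space M))"
        by (rule prod.UNION_disjoint[symmetric]) (simp_all add: \<open>finite I\<close> disj)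
      finally show "prob (\<Inter>j\<in>?J. Y j -` A j \<inter> space M) =
        (\<Prod>j\<in>?J. prob (Y j -` A j \<inter> space M))" .
    qed
  qed (auto simp: sets.sigma_sets_eq Int_stable_def sets.space_closed dest: sets.sets_into_space)
qed

lemma (in prob_space) indep_vars_singleton:
  assumes "random_variable (N i) (Y i)"
  shows "indep_vars N Y {i}"
  using assms by (auto simp: indep_vars_def2 indep_sets_def subset_singleton_iff)

text \<open>Stability under intersection is what lets independence of such event systems pass to the
  sigma-algebras generated by unions of them.\<close>

lemma Int_stable_rv_events: "Int_stable (rv_events M N f)"
proof (rule Int_stableI)
  fix a b assume "a \<in> rv_events M N f" "b \<in> rv_events M N f"
  then obtain A B where "A \<in> sets N" "B \<in> sets N" "a \<inter> b = f -` (A \<inter> B) \<inter> space M"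
    by (auto simp: rv_events_def)
  then show "a \<inter> b \<in> rv_events M N f"
    unfolding rv_events_def using sets.Int by blast
qed

text \<open>The tree recursion is given only for points of \<open>space M\<close>, so the functions
  themselves need not be equal. Independence refers to preimages cut down to \<open>space M\<close>,
  where they agree.\<close>

lemma (in prob_space) indep_vars_cong_on_space:
  assumes eq: "\<And>i \<omega>. i \<in> I \<Longrightarrow> \<omega> \<in> space M \<Longrightarrow> Y i \<omega> = Z i \<omega>"
  shows "indep_vars N Y I \<longleftrightarrow> indep_vars N Z I"
proof -
  have "Y i -` A \<inter> space M = Z i -` A \<inter> space M" if "i \<in> I" for i A
    using eq[OF that] by auto
  then show ?thesis
    unfolding indep_vars_def2
    by (intro conj_cong ball_cong indep_sets_cong) (simp_all add: eq cong: measurable_cong)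
qed

theorem theorem8:
  fixes m k U :: nat
    and X :: "real measure"
    and \<nu> :: "'e measure"
    and \<theta> :: "nat \<Rightarrow> 'e \<times> real \<Rightarrow> real"
    and M :: "'w measure"
    and C :: "nat \<Rightarrow> nat \<Rightarrow> 'w \<Rightarrow> 'e"
    and S :: "nat \<Rightarrow> nat \<Rightarrow> 'w \<Rightarrow> real"
  assumes "m \<ge> 1" and "U = 2 ^ m"
    and "real_distribution X"
    and "prob_space \<nu>"
    and "\<And>n. n \<in> {2 ^ j | j. j < m} \<Longrightarrow> \<theta> n \<in> borel_measurable (\<nu> \<Otimes>\<^sub>M borel)"
    and "\<And>n. n \<in> {2 ^ j | j. j < m} \<Longrightarrow> splitting_map X \<nu> n (\<theta> n)"
    and "prob_space M"
    and "S 0 0 \<in> borel_measurable M"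
    and "distr M borel (S 0 0) = conv_power X U"
    and "\<And>l i. l < m \<Longrightarrow> i < 2 ^ l \<Longrightarrow> C l i \<in> measurable M \<nu>"
    and "\<And>l i. l < m \<Longrightarrow> i < 2 ^ l \<Longrightarrow> distr M \<nu> (C l i) = \<nu>"
    and "\<And>l i \<omega>. l < m \<Longrightarrow> i < 2 ^ l \<Longrightarrow> \<omega> \<in> space M \<Longrightarrow>
           S (l + 1) (2 * i) \<omega> = \<theta> (U div 2 ^ (l + 1)) (C l i \<omega>, S l i \<omega>)"
    and "\<And>l i \<omega>. l < m \<Longrightarrow> i < 2 ^ l \<Longrightarrow> \<omega> \<in> space M \<Longrightarrow>
           S (l + 1) (2 * i + 1) \<omega> = S l i \<omega> - S (l + 1) (2 * i) \<omega>"
    and "k \<ge> 1"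
    and "indep_root_levels M \<nu> m (S 0 0) C"
    and "\<And>l. l < m \<Longrightarrow> kwise_indep_vars M k (\<lambda>_. \<nu>) (C l) {..<2 ^ l}"
  shows "\<forall>l. 1 \<le> l \<and> l \<le> m \<longrightarrow> kwise_indep_vars M k (\<lambda>_. borel) (S l) {..<2 ^ l}"
proof -
  note U = assms(2) and \<theta> = assms(5) and split = assms(6) and root = assms(8,9)
    and C = assms(10) and lawC = assms(11) and step = assms(12,13)
    and indep = assms(15) and Ck = assms(16)
  interpret prob_space M by fact
  have half: "U div 2 ^ (l + 1) = 2 ^ (m - Suc l)" if "l < m" for l
    using that by (simp add: U power_diff flip: power_Suc)
  have half_mem: "2 ^ (m - Suc l) \<in> {2 ^ j :: nat | j. j < m}" if "l < m" for l
    using that by (auto intro!: exI[of _ "m - Suc l"])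
  have t_meas: "\<theta> (U div 2 ^ (l + 1)) \<in> borel_measurable (\<nu> \<Otimes>\<^sub>M borel)" if "l < m" for l
    using \<theta>[OF half_mem[OF that]] half[OF that] by simp

  \<comment> \<open>Sigma-algebras of the past and of the current seeds\<close>
  define E where "E = (\<lambda>j. case j of None \<Rightarrow> rv_events M borel (S 0 0)
    | Some l \<Rightarrow> rv_events M (PiM {..<2 ^ l} (\<lambda>_. \<nu>)) (\<lambda>\<omega>. \<lambda>i\<in>{..<2 ^ l}. C l i \<omega>))"
  have E: "indep_sets E (insert None (Some ` {..<m}))"
    using indep by (simp add: indep_root_levels_def E_def)
  have E_stable: "Int_stable (E j)" for j
    by (simp add: E_def Int_stable_rv_events split: option.split)
  have E_Pow: "E j \<subseteq> Pow (space M)" for j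
    by (auto simp: E_def rv_events_def split: option.split)
  have E_events: "E j \<subseteq> events" if "j \<in> insert None (Some ` {..<m})" for j
    using E that by (auto simp: indep_sets_def)
  \<comment> \<open>\<open>past l\<close> stops strictly below level \<open>l\<close>: the sums at
    level \<open>l\<close> use the root and the seeds of levels less than \<open>l\<close>.
    \<open>F l\<close> is generated by this past and \<open>G l\<close> by the seed vector of level
    \<open>l\<close>, so \<open>F (Suc l)\<close> contains both.\<close>
  define past where "past l = insert None (Some ` {..<l})" for l :: nat
  define F where "F l = sigma (space M) (\<Union>j\<in>past l. E j)" for l
  define G where "G l = sigma (space M) (E (Some l))" for l
  have space [simp]: "space (F l) = space M" "space (G l) = space M" for l
    by (simp_all add: F_def G_def space_measure_of_conv)
  have sets_F: "sets (F l) = sigma_sets (space M) (\<Union>j\<in>past l. E j)" for l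
    unfolding F_def using E_Pow by (intro sets_measure_of) blast
  have sets_G: "sets (G l) = sigma_sets (space M) (E (Some l))" for l
    unfolding G_def using E_Pow by (intro sets_measure_of) blast
  have F_mono: "sets (F l) \<subseteq> sets (F (Suc l))" for l
    unfolding sets_F by (rule sigma_sets_mono') (auto simp: past_def)
  have G_F: "sets (G l) \<subseteq> sets (F (Suc l))" for l
    unfolding sets_F sets_G by (rule sigma_sets_mono') (auto simp: past_def)
  have F_events: "sets (F l) \<subseteq> events" if "l \<le> m" for l
    unfolding sets_F using that by (intro sets.sigma_sets_subset UN_least E_events) (auto simp: past_def)
  have FG: "indep_set (sets (G l)) (sets (F l))" if "l < m" for l
  proof -
    \<comment> \<open>Grouping independent intersection-stable systems into disjoint blocks gives
      independent generated sigma-algebras; the two blocks are level \<open>l\<close> and its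
      past.\<close>
    let ?I = "case_bool {Some l} (past l)"
    have "indep_sets (\<lambda>b. sigma_sets (space M) (\<Union>j\<in>?I b. E j)) UNIV"
    proof (rule indep_sets_collect_sigma)
      show "indep_sets E (\<Union>b. ?I b)"
        by (rule indep_sets_mono_index[OF _ E])
          (use that in \<open>auto simp: past_def split: bool.splits\<close>)
      show "disjoint_family ?I"
        by (auto simp: disjoint_family_on_def past_def split: bool.splits)
    qed (rule E_stable)
    also have "(\<lambda>b. sigma_sets (space M) (\<Union>j\<in>?I b. E j)) = case_bool (sets (G l)) (sets (F l))"
      by (auto simp: sets_F sets_G fun_eq_iff split: bool.split)
    finally show ?thesis unfolding indep_set_def .
  qed
  have mono: "f \<in> measurable K N" if "f \<in> measurable K' N" "sets K' \<subseteq> sets K" "space K' = space K"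
    for f :: "'w \<Rightarrow> 'x" and K K' N
    using that by (auto simp: measurable_def)

  \<comment> \<open>Measurability of seeds and sums\<close>
  have C_G: "C l i \<in> measurable (G l) \<nu>" if "l < m" "i < 2 ^ l" for l i
  proof -
    \<comment> \<open>\<open>G l\<close> is generated by the whole seed vector of the level, so a
      single seed is reached as a coordinate of that vector.\<close>
    have "(\<lambda>\<omega>. \<lambda>i\<in>{..<2 ^ l}. C l i \<omega>) \<in> measurable (G l) (PiM {..<2 ^ l} (\<lambda>_. \<nu>))"
    proof (rule measurableI)
      show "(\<lambda>i\<in>{..<2 ^ l}. C l i \<omega>) \<in> space (PiM {..<2 ^ l} (\<lambda>_. \<nu>))" if "\<omega> \<in> space (G l)" for \<omega>
        using measurable_space[OF C[OF \<open>l < m\<close>]] that by (auto simp: space_PiM)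
    qed (auto simp: sets_G E_def rv_events_def)
    from measurable_compose[OF this measurable_component_singleton[of i]] that show ?thesis
      by simp
  qed
  have S_F: "S l i \<in> measurable (F l) borel" if "l \<le> m" "i < 2 ^ l" for l i
    using that
  proof (induction l arbitrary: i)
    case 0
    have "S 0 0 \<in> measurable (F 0) borel"
      by (rule measurableI) (auto simp: sets_F past_def E_def rv_events_def)
    with 0 show ?case by simp
  next
    case (Suc l)
    have l: "l < m" and i2: "i div 2 < 2 ^ l" using Suc.prems by auto
    let ?t = "\<theta> (U div 2 ^ (l + 1))"
    note t_meas[OF l, measurable]
    have [measurable]: "C l (i div 2) \<in> measurable (F (Suc l)) \<nu>"
      by (rule mono[OF C_G[OF l i2] G_F]) simp
    have [measurable]: "S l (i div 2) \<in> borel_measurable (F (Suc l))"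
      using l by (intro mono[OF Suc.IH[OF _ i2] F_mono]) auto
    have "(\<lambda>\<omega>. ?t (C l (i div 2) \<omega>, S l (i div 2) \<omega>)) \<in> borel_measurable (F (Suc l))"
      by measurable
    \<comment> \<open>Node \<open>i\<close> has parent \<open>i div 2\<close>. The even child comes
      first because the recursion defines its sibling as the parent minus the even child.\<close>
    then have even: "S (Suc l) (2 * (i div 2)) \<in> borel_measurable (F (Suc l))"
      by (rule iffD2[OF measurable_cong, rotated]) (use step(1)[OF l i2] in simp)
    then have "(\<lambda>\<omega>. S l (i div 2) \<omega> - S (Suc l) (2 * (i div 2)) \<omega>)
        \<in> borel_measurable (F (Suc l))"
      by measurable
    then have odd: "S (Suc l) (2 * (i div 2) + 1) \<in> borel_measurable (F (Suc l))"
      by (rule iffD2[OF measurable_cong, rotated]) (use step(2)[OF l i2] in simp)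
    from even odd show ?case
      by (cases "even i") auto
  qed
  have S_M: "S l i \<in> borel_measurable M" if "l \<le> m" "i < 2 ^ l" for l i
    by (rule mono[OF S_F[OF that] F_events[OF that(1)]]) simp

  \<comment> \<open>The two children of one parent, and the laws of the sums\<close>
  have children: "indep_var borel (S (Suc l) (2 * i)) borel (S (Suc l) (2 * i + 1)) \<and>
      distr M borel (S (Suc l) (2 * i)) = conv_power X (2 ^ (m - Suc l)) \<and>
      distr M borel (S (Suc l) (2 * i + 1)) = conv_power X (2 ^ (m - Suc l))"
    if l: "l < m" and i: "i < 2 ^ l" and law: "distr M borel (S l i) = conv_power X (2 ^ (m - l))"
    for l i
  proof -
    let ?n = "2 ^ (m - Suc l) :: nat"
    have n2: "2 ^ (m - l) = 2 * ?n"
      using l by (simp add: Suc_diff_Suc flip: power_Suc)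
    note nm = half_mem[OF l]
    \<comment> \<open>The seed is measurable in \<open>G l\<close> and the parent sum in
      \<open>F l\<close>, so their independence, required by the splitting property, is inherited
      from \<open>FG\<close>.\<close>
    have ind: "indep_set (rv_events M \<nu> (C l i)) (rv_events M borel (S l i))"
    proof (rule indep_setI)
      show "rv_events M \<nu> (C l i) \<subseteq> events" "rv_events M borel (S l i) \<subseteq> events"
        using C[OF l i] S_M[of l i] l i by (auto simp: rv_events_def)
      fix a b assume "a \<in> rv_events M \<nu> (C l i)" "b \<in> rv_events M borel (S l i)"
      then have "a \<in> sets (G l)" "b \<in> sets (F l)"
        using measurable_sets[OF C_G[OF l i]] measurable_sets[OF S_F[of l i]] l i
        by (auto simp: rv_events_def)
      then show "prob (a \<inter> b) = prob a * prob b"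
        by (rule indep_setD[OF FG[OF l]])
    qed
    note sp = splitting_map_any_space[OF split[OF nm] \<theta>[OF nm] \<open>prob_space M\<close> C[OF l i] S_M
        lawC[OF l i] law[unfolded n2] ind]
    have ev: "\<And>\<omega>. \<omega> \<in> space M \<Longrightarrow> S (Suc l) (2 * i) \<omega> = \<theta> ?n (C l i \<omega>, S l i \<omega>)"
      and od: "\<And>\<omega>. \<omega> \<in> space M \<Longrightarrow>
        S (Suc l) (2 * i + 1) \<omega> = S l i \<omega> - \<theta> ?n (C l i \<omega>, S l i \<omega>)"
      using step[OF l i] half[OF l] by auto
    \<comment> \<open>Independence of two variables is an equation between their joint law and the
      product of their laws. Laws depend only on values on \<open>space M\<close>, so the result for
      the splitting formulas transfers to the children.\<close>
    have "distr M borel (S (Suc l) (2 * i)) = distr M borel (\<lambda>\<omega>. \<theta> ?n (C l i \<omega>, S l i \<omega>))"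
      "distr M borel (S (Suc l) (2 * i + 1)) =
        distr M borel (\<lambda>\<omega>. S l i \<omega> - \<theta> ?n (C l i \<omega>, S l i \<omega>))"
      "distr M (borel \<Otimes>\<^sub>M borel) (\<lambda>\<omega>. (S (Suc l) (2 * i) \<omega>, S (Suc l) (2 * i + 1) \<omega>)) =
        distr M (borel \<Otimes>\<^sub>M borel)
          (\<lambda>\<omega>. (\<theta> ?n (C l i \<omega>, S l i \<omega>), S l i \<omega> - \<theta> ?n (C l i \<omega>, S l i \<omega>)))"
      by (rule distr_cong; use ev od in simp)+
    moreover have "S (Suc l) (2 * i) \<in> borel_measurable M"
      "S (Suc l) (2 * i + 1) \<in> borel_measurable M"
      using l i by (auto intro!: S_M)
    ultimately show ?thesis
      using sp l i by (simp add: indep_var_distribution_eq)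
  qed
  \<comment> \<open>This discharges the assumption on the parent's law in \<open>children\<close>,
    whose conclusion about the laws of the children is the induction step here.\<close>
  have lawS: "distr M borel (S l i) = conv_power X (2 ^ (m - l))" if "l \<le> m" "i < 2 ^ l" for l i
    using that
  proof (induction l arbitrary: i)
    case 0
    then show ?case using root(2) by (simp add: U)
  next
    case (Suc l)
    then have l: "l < m" and i: "i div 2 < 2 ^ l" by auto
    from children[OF l i Suc.IH[OF _ i]] l show ?case
      by (cases "even i") auto
  qed

  \<comment> \<open>Induction on the level\<close>
  have main: "kwise_indep_vars M k (\<lambda>_. borel) (S l) {..<2 ^ l}" if "l \<le> m" for l
    using that
  proof (induction l)
    case 0
    \<comment> \<open>The induction starts at the root, where the family has a single
      member.\<close>
    have "indep_vars (\<lambda>_. borel) (S 0) {0}"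
      using root(1) by (rule indep_vars_singleton)
    then show ?case
      by (auto simp: kwise_indep_vars_def lessThan_Suc intro: indep_vars_subset)
  next
    case (Suc l)
    then have l: "l < m" by simp
    show ?case
      unfolding kwise_indep_vars_def
    proof (intro allI impI)
      fix J :: "nat set" assume J: "J \<subseteq> {..<2 ^ Suc l} \<and> finite J \<and> card J \<le> k"
      let ?t = "\<theta> (U div 2 ^ (l + 1))"
      \<comment> \<open>\<open>I\<close> is the set of parents of \<open>J\<close>. Passing to
        parents cannot increase the cardinality, so \<open>card I \<le> k\<close> and
        \<open>k\<close>-wise independence at level \<open>l\<close> covers all of
        \<open>I\<close>.\<close>
      define I where "I = (\<lambda>j. j div 2) ` J"
      have I: "I \<subseteq> {..<2 ^ l}" "finite I" "card I \<le> k"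
        using J card_image_le[of J "\<lambda>j. j div 2"] by (auto simp: I_def)
      have "indep_vars (\<lambda>_. \<nu> \<Otimes>\<^sub>M borel) (\<lambda>i \<omega>. (C l i \<omega>, S l i \<omega>)) I"
      proof (rule indep_vars_Pair[OF \<open>finite I\<close> _ _ FG[OF l]])
        show "indep_vars (\<lambda>_. \<nu>) (C l) I" "indep_vars (\<lambda>_. borel) (S l) I"
          using Ck[OF l] Suc.IH l I by (auto simp: kwise_indep_vars_def)
      qed (use C_G[OF l] S_F[of l] l I in auto)
      \<comment> \<open>Both children are one measurable function of the parent's pair (seed, sum),
        so independence across parents is preserved.\<close>
      then have "indep_vars (\<lambda>_. borel \<Otimes>\<^sub>M borel)
          (\<lambda>i \<omega>. (\<lambda>p. (?t p, snd p - ?t p)) (C l i \<omega>, S l i \<omega>)) I"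
        by (rule indep_vars_compose2) (use t_meas[OF l] in measurable)
      then have pairs: "indep_vars (\<lambda>_. borel \<Otimes>\<^sub>M borel)
          (\<lambda>i \<omega>. (S (Suc l) (2 * i) \<omega>, S (Suc l) (2 * i + 1) \<omega>)) I"
        by (rule iffD1[OF indep_vars_cong_on_space, rotated]) (use step[OF l] I in auto)
      \<comment> \<open>All children of the parents in \<open>I\<close>, possibly more than
        \<open>k\<close> of them, are mutually independent; \<open>J\<close> is a subfamily.\<close>
      have "indep_vars (\<lambda>_. borel) (S (Suc l)) (\<Union>i\<in>I. {2 * i, 2 * i + 1})"
        by (rule indep_vars_unpair[OF \<open>finite I\<close> pairs])
          (use children[OF l] lawS[of l] l I in auto)
      moreover have "J \<subseteq> (\<Union>i\<in>I. {2 * i, 2 * i + 1})"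
        unfolding I_def by (auto; presburger)
      ultimately show "indep_vars (\<lambda>_. borel) (S (Suc l)) J"
        by (rule indep_vars_subset)
    qed
  qed
  then show ?thesis by simp
qed

end
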